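(* Let $A$ be an invertible real $n\times n$ matrix, let $x_0,b\in\mathbb{R}^n$, and let $x_*=A^{-1}b$. For $j=0,1,2,\ldots$ put $$y_j=x_*+R_A^{2j}(x_0-x_* ),\qquad z_j=x_*+R_A^{2j+1}(x_0-x_* ).$$ Let $\varepsilon>0$ and $$N=\left\lceil \frac{\pi\,\eta(A)}{2\varepsilon}\right\rceil .$$ Then $$\left\|\frac{1}{2N}\sum_{j=0}^{N-1}(y_j+z_j)-x_*\right\|\le \varepsilon\,\|x_0-x_*\|.$$
   Context: Let $A_i^{T}$ denote the $i$-th row of $A$ (so $A_i$ is a column vector), $R_i=I_n-2\frac{A_iA_i^{T}}{\|A_i\|^2}$, and $R_A=R_n\cdots R_2R_1$, an orthogonal matrix. Write the eigenvalues of $R_A$ as $e^{i\theta_1},\ldots,e^{i\theta_n}$ with $|\theta_l|\le\pi$. The eigengap inverse is $\eta(A)=\dfrac{1}{\min_{l:\theta_l\ne 0}|\theta_l|}$. The norm $\|\cdot\|$ is the Euclidean norm. *)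

theory Defs
  imports "HOL-Analysis.Analysis"
begin

definition householder :: "real ^ 'n \<Rightarrow> real ^ 'n ^ 'n" where
  "householder a = mat 1 - (2 / (norm a)\<^sup>2) *\<^sub>R (\<chi> i j. a $ i * a $ j)"

text \<open>
  The rows are indexed by a finite linearly ordered type, whose increasing enumeration plays the
  role of \<open>1, \<dots>, n\<close>. The reflection in the first row is applied first, so it is the rightmost
  factor: \<open>R\<^sub>n ** \<dots> ** R\<^sub>2 ** R\<^sub>1\<close>.
\<close>

definition reflection_product ::
    "real ^ 'n::{finite,linorder} ^ 'n::{finite,linorder} \<Rightarrow>
     real ^ 'n::{finite,linorder} ^ 'n::{finite,linorder}" where
  "reflection_product A =
     fold (\<lambda>i M. householder (row i A) ** M) (sorted_list_of_set UNIV) (mat 1)"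

text \<open>The operation \<open>^\<close> on the type of vectors is componentwise, hence a separate matrix power.\<close>

primrec matrix_power :: "'a::semiring_1 ^ 'n ^ 'n \<Rightarrow> nat \<Rightarrow> 'a ^ 'n ^ 'n" where
  "matrix_power M 0 = mat 1"
| "matrix_power M (Suc k) = M ** matrix_power M k"

definition complex_eigenvalue :: "real ^ 'n ^ 'n \<Rightarrow> complex \<Rightarrow> bool" where
  "complex_eigenvalue M c \<longleftrightarrow>
     (\<exists>v. v \<noteq> 0 \<and> map_matrix complex_of_real M *v v = c *s v)"

text \<open>
  The arguments in \<open>[-\<pi>, \<pi>]\<close> of the eigenvalues on the unit circle (for an orthogonal matrix, of
  all eigenvalues). An eigenvalue \<open>-1\<close> contributes both \<open>\<pi>\<close> and \<open>-\<pi>\<close>, and multiplicities are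
  forgotten; neither affects a minimum of absolute values.
\<close>

definition eigenangles :: "real ^ 'n ^ 'n \<Rightarrow> real set" where
  "eigenangles M = {\<theta>. \<bar>\<theta>\<bar> \<le> pi \<and> complex_eigenvalue M (cis \<theta>)}"

definition eigengap_inverse :: "real ^ 'n::{finite,linorder} ^ 'n::{finite,linorder} \<Rightarrow> real" where
  "eigengap_inverse A =
     1 / Min {\<bar>\<theta>\<bar> |\<theta>. \<theta> \<in> eigenangles (reflection_product A) \<and> \<theta> \<noteq> 0}"

end

theory Submission
  imports Defs
begin

text \<open>
  Since the rows of \<open>A\<close> are independent, \<open>R = R\<^sub>A\<close> has no nonzero fixed vector, so
  \<open>x\<^sub>0 - x\<^sub>* = R u - u\<close> for some \<open>u\<close>, and the sum of the first \<open>2 N\<close> iterates of \<open>x\<^sub>0 - x\<^sub>*\<close>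
  telescopes to \<open>R\<^sup>2\<^sup>N u - u\<close>, of norm at most \<open>2 \<parallel>u\<parallel>\<close>.
  Instead of diagonalising \<open>R\<close>, one maximises \<open>x \<bullet> R x\<close> on the unit sphere: the maximum is the
  largest eigenvalue \<open>cos \<theta>\<close> of \<open>(R + R\<^sup>-\<^sup>1) / 2\<close>, where \<open>\<theta>\<close> is the smallest eigenangle.
  Hence \<open>\<parallel>R u - u\<parallel>\<^sup>2 \<ge> 2 (1 - cos \<theta>) \<parallel>u\<parallel>\<^sup>2 = 4 sin\<^sup>2 (\<theta> / 2) \<parallel>u\<parallel>\<^sup>2\<close>, and
  \<open>sin (\<theta> / 2) \<ge> \<theta> / \<pi>\<close>.
\<close>

section \<open>Products of reflections\<close>

lemma householder_mult_vec:
  "householder a *v x = x - (2 * (a \<bullet> x) / (norm a)\<^sup>2) *\<^sub>R a"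
proof -
  have "(\<chi> i j. a $ i * a $ j) *v x = (a \<bullet> x) *\<^sub>R a"
    by (simp add: vec_eq_iff matrix_vector_mult_def inner_vec_def sum_distrib_left
        sum_distrib_right mult_ac)
  then show ?thesis
    by (simp add: householder_def matrix_vector_mult_diff_rdistrib scaleR_matrix_vector_assoc[symmetric])
qed

lemma orthogonal_transformation_householder:
  "orthogonal_transformation ((*v) (householder a))"
proof -
  have "(householder a *v v) \<bullet> (householder a *v w) = v \<bullet> w" for v w
  \<comment> \<open>At \<open>a = 0\<close> the reflection degenerates to the identity, since it
    only ever adds multiples of \<open>a\<close>.\<close>
  proof (cases "a = 0")
    case False
    then have "(norm a)\<^sup>2 \<noteq> 0" by simp
    then show ?thesis
      unfolding householder_mult_vec
      by (simp add: inner_diff_left inner_diff_right inner_commute field_simps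
          power2_norm_eq_inner)
  qed (simp add: householder_mult_vec)
  then show ?thesis
    by (simp add: orthogonal_transformation_def)
qed

lemma fold_matrix_mult_vec:
  "fold (\<lambda>i M. h i ** M) xs M *v v = fold (\<lambda>i w. h i *v w) xs (M *v v)"
  for h :: "'i \<Rightarrow> real ^ 'n ^ 'n"
  by (induction xs arbitrary: M) (simp_all add: matrix_vector_mul_assoc)

lemma reflection_product_mult_vec:
  "reflection_product A *v v =
     fold (\<lambda>i w. householder (row i A) *v w) (sorted_list_of_set UNIV) v"
  by (simp add: reflection_product_def fold_matrix_mult_vec)

lemma orthogonal_transformation_fold:
  assumes "\<And>i. i \<in> set xs \<Longrightarrow> orthogonal_transformation (h i)"
  shows "orthogonal_transformation (fold h xs)"
  using assms
proof (induction xs)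
  case Nil
  then show ?case by (simp add: id_def)
next
  case (Cons a xs)
  then have "orthogonal_transformation (fold h xs \<circ> h a)"
    by (intro orthogonal_transformation_compose) auto
  then show ?case by (simp add: comp_def)
qed

lemma orthogonal_transformation_reflection_product:
  "orthogonal_transformation ((*v) (reflection_product A))"
  unfolding reflection_product_mult_vec
  by (rule orthogonal_transformation_fold) (rule orthogonal_transformation_householder)

text \<open>Each reflection moves its argument along its own normal, so the displacements add up
  inside the span of the normals.\<close>

lemma fold_householder_diff_in_span:
  "fold (\<lambda>i w. householder (a i) *v w) xs v - v \<in> span (a ` set xs)"
proof (induction xs arbitrary: v)
  case (Cons i xs)
  let ?w = "householder (a i) *v v"
  have "?w - v \<in> span (a ` set (i # xs))"
    by (simp add: householder_mult_vec span_base span_mul span_neg)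
  moreover have "fold (\<lambda>i w. householder (a i) *v w) xs ?w - ?w \<in> span (a ` set (i # xs))"
    using Cons span_mono[of "a ` set xs" "a ` set (i # xs)"] by auto
  ultimately have "(fold (\<lambda>i w. householder (a i) *v w) xs ?w - ?w) + (?w - v)
      \<in> span (a ` set (i # xs))"
    by (rule span_add[rotated])
  then show ?case by simp
qed (simp add: span_zero)

text \<open>If the product fixes \<open>v\<close>, the later reflections undo the first one. Its
  displacement, a multiple of \<open>a k\<close>, thus lies in the span of the other normals and
  vanishes by independence. So \<open>v\<close> is orthogonal to \<open>a k\<close>, the first
  reflection fixes \<open>v\<close>, and the induction continues with the rest.\<close>

lemma fold_householder_fixed_imp_orthogonal:
  assumes "distinct xs" "inj_on a (set xs)" "independent (a ` set xs)"
    and "fold (\<lambda>i w. householder (a i) *v w) xs v = v" and "i \<in> set xs"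
  shows "a i \<bullet> v = 0"
  using assms
proof (induction xs arbitrary: v)
  case (Cons k xs)
  let ?w = "householder (a k) *v v"
  let ?F = "fold (\<lambda>i w. householder (a i) *v w) xs"
  define t where "t = 2 * (a k \<bullet> v) / (norm (a k))\<^sup>2"
  have notin: "a k \<notin> a ` set xs" using Cons.prems(1,2) by auto
  have ind: "independent (a ` set xs)" and nspan: "a k \<notin> span (a ` set xs)"
    using Cons.prems(3) notin by (auto simp: independent_insert)
  have F: "?F ?w = v" using Cons.prems(4) by simp
  have "v - ?w \<in> span (a ` set xs)"
    using fold_householder_diff_in_span[of a xs ?w] F by simp
  then have "t *\<^sub>R a k \<in> span (a ` set xs)"
    by (simp add: householder_mult_vec t_def)
  then have "t = 0"
    using nspan by (metis span_mul scaleR_scaleR left_inverse scaleR_one)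
  moreover have "a k \<noteq> 0" using nspan span_zero by metis
  ultimately have k: "a k \<bullet> v = 0" by (simp add: t_def)
  then have "?w = v" by (simp add: householder_mult_vec)
  then have "a i \<bullet> v = 0" if "i \<in> set xs"
    using Cons.IH[of v] Cons.prems ind F that by auto
  then show ?case using k Cons.prems(5) by auto
qed simp

text \<open>A fixed vector is orthogonal to every row of \<open>A\<close>, hence lies in the kernel
  of \<open>A\<close>.\<close>

lemma reflection_product_fixed_imp_zero:
  assumes "invertible A" and "reflection_product A *v v = v"
  shows "v = 0"
proof -
  have det: "det A \<noteq> 0" using assms(1) by (simp add: invertible_det_nz)
  have inj: "inj (\<lambda>i. row i A)"
    using det det_identical_rows by (metis injI)
  have rows: "rows A = range (\<lambda>i. row i A)" by (auto simp: rows_def)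
  have ind: "independent (range (\<lambda>i. row i A))"
    using det det_dependent_rows[of A] rows by (auto simp: dependent_vec_eq)
  have "row i A \<bullet> v = 0" for i
    by (rule fold_householder_fixed_imp_orthogonal[of "sorted_list_of_set UNIV" "\<lambda>i. row i A"])
      (use inj ind assms(2) in \<open>auto simp: reflection_product_mult_vec\<close>)
  then have "A *v v = 0"
    by (simp add: vec_eq_iff matrix_vector_mul_component row_def)
  then show "v = 0"
    using assms(1) by (metis matrix_left_invertible_ker invertible_def)
qed

lemma matrix_power_mult_vec: "matrix_power M k *v v = (((*v) M) ^^ k) v"
  by (induction k) (simp_all add: matrix_vector_mul_assoc[symmetric])

section \<open>Orthogonal transformations\<close>

text \<open>
  For an orthogonal transformation \<open>f\<close>, the equation below is \<open>(f + f\<^sup>-\<^sup>1) v = 2 c v\<close>, written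
  without the inverse.
\<close>

definition symmetrized_eigenvalue :: "('a::euclidean_space \<Rightarrow> 'a) \<Rightarrow> real \<Rightarrow> bool" where
  "symmetrized_eigenvalue f c \<longleftrightarrow> (\<exists>v. v \<noteq> 0 \<and> f (f v) + v = (2 * c) *\<^sub>R f v)"

text \<open>Pairing the equation with \<open>f w\<close> and cancelling one \<open>f\<close> in each
  term gives the weak form of the eigenvector equation for the self-adjoint map f + f^-1.\<close>

lemma symmetrized_eigenvector_inner:
  assumes "orthogonal_transformation f" and "f (f v) + v = (2 * c) *\<^sub>R f v"
  shows "f v \<bullet> w + v \<bullet> f w = 2 * c * (v \<bullet> w)"
proof -
  have "f (f v) \<bullet> f w + v \<bullet> f w = 2 * c * (f v \<bullet> f w)"
    using arg_cong[OF assms(2), of "\<lambda>x. x \<bullet> f w"] by (simp add: inner_add_left)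
  then show ?thesis using assms(1) by (simp add: orthogonal_transformation_def)
qed

text \<open>As for any self-adjoint map, eigenvectors of distinct eigenvalues are orthogonal, hence
  independent, and the dimension bounds their number.\<close>

lemma finite_symmetrized_eigenvalues:
  assumes f: "orthogonal_transformation f"
  shows "finite {c. symmetrized_eigenvalue f c}"
proof -
  obtain e where e: "\<And>c. symmetrized_eigenvalue f c \<Longrightarrow> e c \<noteq> 0 \<and> f (f (e c)) + e c = (2 * c) *\<^sub>R f (e c)"
    proof -
    have "\<forall>c. \<exists>v. symmetrized_eigenvalue f c \<longrightarrow> v \<noteq> 0 \<and> f (f v) + v = (2 * c) *\<^sub>R f v"
      by (auto simp: symmetrized_eigenvalue_def)
    then show thesis using that by metis
  qed
  let ?C = "{c. symmetrized_eigenvalue f c}"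
  have orth: "e c \<bullet> e d = 0" if "c \<in> ?C" "d \<in> ?C" "c \<noteq> d" for c d
  proof -
    have "2 * c * (e c \<bullet> e d) = f (e c) \<bullet> e d + e c \<bullet> f (e d)"
      by (rule symmetrized_eigenvector_inner[OF f, symmetric]) (use e that in auto)
    also have "\<dots> = f (e d) \<bullet> e c + e d \<bullet> f (e c)"
      by (simp add: inner_commute)
    also have "\<dots> = 2 * d * (e d \<bullet> e c)"
      by (rule symmetrized_eigenvector_inner[OF f]) (use e that in auto)
    finally show ?thesis using that by (simp add: inner_commute)
  qed
  have "inj_on e ?C"
    using orth e by (metis (mono_tags, lifting) inj_onI inner_eq_zero_iff mem_Collect_eq)
  moreover have "independent (e ` ?C)"
    by (rule pairwise_orthogonal_independent)
      (use orth e in \<open>auto simp: pairwise_def orthogonal_def\<close>)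
  then have "finite (e ` ?C)" by (rule independent_imp_finite)
  ultimately show ?thesis by (rule finite_imageD[rotated])
qed

lemma symmetrized_eigenvalue_bounds:
  assumes f: "orthogonal_transformation f" and "symmetrized_eigenvalue f c"
  shows "-1 \<le> c" "c \<le> 1"
proof -
  obtain v where v: "v \<noteq> 0" "f (f v) + v = (2 * c) *\<^sub>R f v"
    using assms(2) by (auto simp: symmetrized_eigenvalue_def)
  have "v \<bullet> f v = c * (norm v)\<^sup>2"
    using symmetrized_eigenvector_inner[OF f v(2), of v]
    by (simp add: inner_commute power2_norm_eq_inner)
  moreover have "\<bar>v \<bullet> f v\<bar> \<le> (norm v)\<^sup>2"
    using Cauchy_Schwarz_ineq2[of v "f v"] orthogonal_transformation_norm[OF f]
    by (simp add: power2_eq_square)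
  ultimately have "\<bar>c\<bar> * (norm v)\<^sup>2 \<le> 1 * (norm v)\<^sup>2" by (simp add: abs_mult)
  then have "\<bar>c\<bar> \<le> 1" using v(1) by (simp only: mult_le_cancel_right) simp
  then show "-1 \<le> c" "c \<le> 1" by auto
qed

text \<open>This is the equality case of Cauchy-Schwarz for \<open>v\<close> and \<open>f v\<close>,
  which have equal norms.\<close>

lemma symmetrized_eigenvalue_1_imp_fixed:
  assumes f: "orthogonal_transformation f" and "f (f v) + v = 2 *\<^sub>R f v"
  shows "f v = v"
proof -
  have "f v \<bullet> v = v \<bullet> v"
    using symmetrized_eigenvector_inner[OF f, of v 1 v] assms(2) by (simp add: inner_commute)
  then have "(f v - v) \<bullet> (f v - v) = 0"
    using f by (simp add: inner_diff_left inner_diff_right inner_commute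
        orthogonal_transformation_def)
  then show ?thesis by simp
qed

lemma quadratic_nonneg_imp_linear_zero:
  fixes p q :: real
  assumes "\<And>t. 0 \<le> t * p + t\<^sup>2 * q"
  shows "p = 0"
proof (rule ccontr)
  assume "p \<noteq> 0"
  \<comment> \<open>At t = - s p with s this small, the negative linear term outweighs the quadratic
    one.\<close>
  define s where "s = 1 / (\<bar>q\<bar> + 1)"
  have s: "0 < s" "s * q < 1"
    by (auto simp: s_def field_simps)
  have "0 \<le> (- s * p) * p + (- s * p)\<^sup>2 * q" by (rule assms)
  also have "\<dots> = - (s * p\<^sup>2 * (1 - s * q))"
    by (simp add: power2_eq_square algebra_simps)
  also have "\<dots> < 0" using s \<open>p \<noteq> 0\<close> by simp
  finally show False by simp
qed

text \<open>Compactness of the sphere gives a maximiser; its first-order condition is the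
  eigenvector equation.\<close>

lemma exists_max_symmetrized_eigenvalue:
  fixes f :: "'a::euclidean_space \<Rightarrow> 'a"
  assumes f: "orthogonal_transformation f"
  shows "\<exists>c. symmetrized_eigenvalue f c \<and> (\<forall>x. x \<bullet> f x \<le> c * (norm x)\<^sup>2)"
proof -
  have lin: "linear f" using f by (rule orthogonal_transformation_linear)
  have "continuous_on (sphere 0 1) (\<lambda>x. x \<bullet> f x)"
    by (intro continuous_intros linear_continuous_on linear_conv_bounded_linear[THEN iffD1] lin)
  moreover have "sphere (0::'a) 1 \<noteq> {}" by simp
  ultimately obtain v where v: "norm v = 1" and max: "\<And>x. norm x = 1 \<Longrightarrow> x \<bullet> f x \<le> v \<bullet> f v"
    using continuous_attains_sup[of "sphere (0::'a) 1" "\<lambda>x. x \<bullet> f x"] by auto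
  define c where "c = v \<bullet> f v"
  have bound: "x \<bullet> f x \<le> c * (norm x)\<^sup>2" for x
  proof (cases "x = 0")
    case False
    have "(x /\<^sub>R norm x) \<bullet> f (x /\<^sub>R norm x) \<le> c"
      using False max[of "x /\<^sub>R norm x"] by (simp add: c_def)
    then have "(x \<bullet> f x) / (norm x)\<^sup>2 \<le> c"
      by (simp add: linear_cmul[OF lin] power2_eq_square divide_inverse mult_ac)
    then show ?thesis using False by (simp add: divide_le_eq)
  qed (simp add: linear_0[OF lin])
  have "f (f v) + v - (2 * c) *\<^sub>R f v = 0"
  proof -
    \<comment> \<open>As \<open>f\<close> is onto, a residual orthogonal to every \<open>f u\<close>
      is zero.\<close>
    have "(f (f v) + v - (2 * c) *\<^sub>R f v) \<bullet> f u = 0" for u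
    proof -
      \<comment> \<open>This polynomial is the slack of \<open>bound\<close> at v + t u; its
        constant term vanishes because \<open>v\<close> attains the maximum.\<close>
      have "0 \<le> t * (2 * c * (v \<bullet> u) - v \<bullet> f u - u \<bullet> f v) + t\<^sup>2 * (c * (u \<bullet> u) - u \<bullet> f u)" for t
      proof -
        have "v \<bullet> v = 1" using v by (simp add: norm_eq_1)
        then show ?thesis
          using bound[of "v + t *\<^sub>R u"]
          unfolding power2_norm_eq_inner
          by (simp add: linear_add[OF lin] linear_cmul[OF lin]
              inner_add_left inner_add_right inner_commute c_def[symmetric] algebra_simps
              power2_eq_square)
      qed
      then have "2 * c * (v \<bullet> u) - v \<bullet> f u - u \<bullet> f v = 0"
        by (rule quadratic_nonneg_imp_linear_zero)
      then show ?thesis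
        using f by (simp add: inner_diff_left inner_add_left orthogonal_transformation_def
            inner_commute[of u])
    qed
    then show ?thesis
      using orthogonal_transformation_surj[OF f] by (metis inner_eq_zero_iff surjD)
  qed
  then have "symmetrized_eigenvalue f c"
    using v unfolding symmetrized_eigenvalue_def by (intro exI[of _ v]) auto
  then show ?thesis using bound by blast
qed

section \<open>Norms of orbit sums\<close>

lemma orthogonal_transformation_funpow:
  fixes f :: "'a::real_inner \<Rightarrow> 'a"
  assumes "orthogonal_transformation f"
  shows "orthogonal_transformation (f ^^ k)"
proof (induction k)
  case (Suc k)
  show ?case
    unfolding funpow.simps using assms Suc by (rule orthogonal_transformation_compose)
qed (simp add: id_def)

lemma norm_diff_ge_of_inner_le:
  assumes f: "orthogonal_transformation f" and "u \<bullet> f u \<le> cos \<theta> * (norm u)\<^sup>2" "0 \<le> \<theta>" "\<theta> \<le> pi"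
  shows "2 * sin (\<theta> / 2) * norm u \<le> norm (f u - u)"
proof (rule power2_le_imp_le)
  have "(norm (f u - u))\<^sup>2 = 2 * (norm u)\<^sup>2 - 2 * (u \<bullet> f u)"
    using f by (simp add: power2_norm_eq_inner inner_diff_left inner_diff_right inner_commute
        orthogonal_transformation_def)
  also have "\<dots> \<ge> 2 * (norm u)\<^sup>2 * (1 - cos \<theta>)"
    using assms(2) by (simp add: algebra_simps)
  also have "1 - cos \<theta> = 2 * (sin (\<theta> / 2))\<^sup>2"
    using cos_double_sin[of "\<theta> / 2"] by simp
  finally show "(2 * sin (\<theta> / 2) * norm u)\<^sup>2 \<le> (norm (f u - u))\<^sup>2"
    by (simp add: power_mult_distrib mult_ac)
qed simp

lemma sin_half_ge:
  assumes "0 \<le> x" "x \<le> pi"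
  shows "x / pi \<le> sin (x / 2)"
proof -
  have "concave_on {0..pi/2} sin"
    by (rule f''_le0_imp_concave[where f' = cos and f'' = "\<lambda>x. - sin x"])
      (auto intro!: derivative_eq_intros sin_ge_zero)
  then have "convex_on {0..pi/2} (\<lambda>x. - sin x)" by (simp add: concave_on_def)
  \<comment> \<open>The point x / 2 is the convex combination of 0 and pi / 2 with weight x / pi, so
    the chord of sine over [0, pi / 2] gives the bound.\<close>
  then have "- sin ((1 - x / pi) *\<^sub>R 0 + (x / pi) *\<^sub>R (pi / 2))
      \<le> (1 - x / pi) * (- sin 0) + (x / pi) * (- sin (pi / 2))"
    by (rule convex_onD_Icc) (use assms in auto)
  then show ?thesis by simp
qed

lemma norm_sum_funpow_le:
  fixes f :: "'a::euclidean_space \<Rightarrow> 'a"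
  assumes f: "orthogonal_transformation f" and fixed: "\<And>v. f v = v \<Longrightarrow> v = 0"
    and max: "\<And>x. x \<bullet> f x \<le> cos \<theta> * (norm x)\<^sup>2" and \<theta>: "0 < \<theta>" "\<theta> \<le> pi"
  shows "norm (\<Sum>k<n. (f ^^ k) w) \<le> pi / \<theta> * norm w"
proof -
  have lin: "linear (\<lambda>u. f u - u)"
    using f by (intro linear_compose_sub) (auto simp: orthogonal_transformation_linear linear_id)
  moreover have "inj (\<lambda>u. f u - u)"
    using fixed by (simp add: linear_injective_0[OF lin])
  ultimately have "surj (\<lambda>u. f u - u)" by (simp add: linear_injective_imp_surjective)
  then obtain u where u: "w = f u - u" by (rule surjE)
  have "(f ^^ k) w = (f ^^ Suc k) u - (f ^^ k) u" for k
  proof -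
    have "linear (f ^^ k)"
      using f by (intro orthogonal_transformation_linear orthogonal_transformation_funpow)
    then have "(f ^^ k) w = (f ^^ k) (f u) - (f ^^ k) u"
      unfolding u by (rule linear_diff)
    then show ?thesis by (simp only: funpow_Suc_right comp_apply)
  qed
  then have "(\<Sum>k<n. (f ^^ k) w) = (f ^^ n) u - u"
    using sum_lessThan_telescope[of "\<lambda>k. (f ^^ k) u" n] by simp
  also have "norm \<dots> \<le> norm ((f ^^ n) u) + norm u" by (rule norm_triangle_ineq4)
  also have "\<dots> = 2 * norm u"
    using orthogonal_transformation_norm[OF orthogonal_transformation_funpow[OF f]] by simp
  also have "\<dots> \<le> pi / \<theta> * norm w"
  proof -
    have "2 * (\<theta> / pi) * norm u \<le> 2 * sin (\<theta> / 2) * norm u"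
      using sin_half_ge[of \<theta>] \<theta> by (intro mult_right_mono) auto
    also have "\<dots> \<le> norm w"
      unfolding u by (rule norm_diff_ge_of_inner_le[OF f max]) (use \<theta> in auto)
    finally show ?thesis using \<theta> by (simp add: field_simps)
  qed
  finally show ?thesis .
qed

section \<open>Eigenangles\<close>

text \<open>The vector a + i b: a complex eigenvector of a real matrix becomes a pair of real
  vectors.\<close>

definition complex_vec :: "real ^ 'n \<Rightarrow> real ^ 'n \<Rightarrow> complex ^ 'n" where
  "complex_vec a b = (\<chi> i. Complex (a $ i) (b $ i))"

lemma map_matrix_complex_vec:
  "map_matrix complex_of_real M *v complex_vec a b = complex_vec (M *v a) (M *v b)"
  by (simp add: vec_eq_iff complex_vec_def matrix_vector_mult_def complex_eq_iff)

lemma cis_mult_complex_vec: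
  "cis \<theta> *s complex_vec a b =
     complex_vec (cos \<theta> *\<^sub>R a - sin \<theta> *\<^sub>R b) (sin \<theta> *\<^sub>R a + cos \<theta> *\<^sub>R b)"
  by (simp add: vec_eq_iff complex_vec_def complex_eq_iff)

lemma complex_vec_eq_iff: "complex_vec a b = complex_vec c d \<longleftrightarrow> a = c \<and> b = d"
  by (auto simp: vec_eq_iff complex_vec_def)

lemma complex_eigenvalue_cis_iff:
  "complex_eigenvalue M (cis \<theta>) \<longleftrightarrow>
     (\<exists>a b. (a \<noteq> 0 \<or> b \<noteq> 0) \<and> M *v a = cos \<theta> *\<^sub>R a - sin \<theta> *\<^sub>R b
        \<and> M *v b = sin \<theta> *\<^sub>R a + cos \<theta> *\<^sub>R b)"
proof -
  have ex: "(\<exists>v. P v) \<longleftrightarrow> (\<exists>a b. P (complex_vec a b))" for P :: "complex ^ 'n \<Rightarrow> bool"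
  proof -
    have "v = complex_vec (\<chi> i. Re (v $ i)) (\<chi> i. Im (v $ i))" for v :: "complex ^ 'n"
      by (simp add: vec_eq_iff complex_vec_def)
    then show ?thesis by metis
  qed
  have nonzero: "complex_vec a b \<noteq> 0 \<longleftrightarrow> a \<noteq> 0 \<or> b \<noteq> 0" for a b :: "real ^ 'n"
    by (auto simp: vec_eq_iff complex_vec_def complex_eq_iff)
  then show ?thesis
    unfolding complex_eigenvalue_def ex nonzero
    by (simp only: map_matrix_complex_vec cis_mult_complex_vec complex_vec_eq_iff)
qed

text \<open>On the real and imaginary parts of an eigenvector, \<open>M\<close> acts like a rotation
  by \<theta>, whose characteristic polynomial X^2 - 2 (cos \<theta>) X + 1 annihilates both parts;
  one of them is nonzero.\<close>

lemma eigenangle_imp_symmetrized_eigenvalue: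
  assumes "\<theta> \<in> eigenangles M"
  shows "symmetrized_eigenvalue ((*v) M) (cos \<theta>)"
proof -
  obtain a b where ab: "a \<noteq> 0 \<or> b \<noteq> 0" and a: "M *v a = cos \<theta> *\<^sub>R a - sin \<theta> *\<^sub>R b"
    and b: "M *v b = sin \<theta> *\<^sub>R a + cos \<theta> *\<^sub>R b"
    using assms by (auto simp: eigenangles_def complex_eigenvalue_cis_iff)
  have s: "sin \<theta> * (sin \<theta> * x) = x - cos \<theta> * (cos \<theta> * x)" for x
  proof -
    have "(sin \<theta>)\<^sup>2 * x = x - (cos \<theta>)\<^sup>2 * x"
      unfolding sin_squared_eq by (simp add: left_diff_distrib)
    then show ?thesis by (simp add: power2_eq_square mult.assoc)
  qed
  have "M *v (M *v a) + a = (2 * cos \<theta>) *\<^sub>R (M *v a)"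
    by (simp add: a b matrix_vector_mult_diff_distrib matrix_vector_mult_scaleR vec_eq_iff s
        algebra_simps)
  moreover have "M *v (M *v b) + b = (2 * cos \<theta>) *\<^sub>R (M *v b)"
    by (simp add: a b matrix_vector_right_distrib matrix_vector_mult_scaleR vec_eq_iff s
        algebra_simps)
  ultimately show ?thesis
    using ab unfolding symmetrized_eigenvalue_def by blast
qed

lemma symmetrized_eigenvalue_imp_eigenangle:
  assumes f: "orthogonal_transformation ((*v) M)" and fixed: "\<And>v. M *v v = v \<Longrightarrow> v = 0"
    and c: "symmetrized_eigenvalue ((*v) M) c"
  shows "arccos c \<in> eigenangles M" "0 < arccos c"
proof -
  note bounds = symmetrized_eigenvalue_bounds[OF f c]
  obtain a where a: "a \<noteq> 0" "M *v (M *v a) + a = (2 * c) *\<^sub>R (M *v a)"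
    using c by (auto simp: symmetrized_eigenvalue_def)
  have "c \<noteq> 1"
    using symmetrized_eigenvalue_1_imp_fixed[OF f, of a] a fixed by auto
  then show pos: "0 < arccos c" using bounds arccos_lt_bounded[of c] arccos_minus_1
    by (cases "c = -1") auto
  define \<theta> where "\<theta> = arccos c"
  have cos: "cos \<theta> = c" and le: "\<bar>\<theta>\<bar> \<le> pi"
    using bounds pos by (auto simp: \<theta>_def arccos_ubound)
  have "complex_eigenvalue M (cis \<theta>)"
  \<comment> \<open>Here c = -1, as c = 1 is excluded. Then \<open>a\<close> satisfies the equation
    of eigenvalue 1 for -M, so -M fixes it and it serves as a real eigenvector.\<close>
  proof (cases "sin \<theta> = 0")
    case True
    then have "c = -1"
      using \<open>c \<noteq> 1\<close> sin_zero_abs_cos_one[of \<theta>] by (auto simp: cos abs_if split: if_splits)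
    have "orthogonal_transformation (\<lambda>v. - (M *v v))"
      using f by (simp add: orthogonal_transformation_neg)
    from symmetrized_eigenvalue_1_imp_fixed[OF this, of a]
    have "- (M *v a) = a"
      using a(2) \<open>c = -1\<close> by (simp add: matrix_vector_mult_scaleR[of M "-1", simplified])
    then have "M *v a = - a" by (metis minus_minus)
    then show ?thesis
      unfolding complex_eigenvalue_cis_iff using a(1) True cos \<open>c = -1\<close>
      by (intro exI[of _ a] exI[of _ 0]) simp
  next
    case False
    \<comment> \<open>The imaginary part is forced by M a = (cos \<theta>) a - (sin \<theta>) b; the
      equation for M b then follows from the one for M (M a).\<close>
    define b where "b = (1 / sin \<theta>) *\<^sub>R (c *\<^sub>R a - M *v a)"
    have sb: "sin \<theta> *\<^sub>R b = c *\<^sub>R a - M *v a"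
      using False by (simp add: b_def)
    have Mb: "M *v b = (1 / sin \<theta>) *\<^sub>R (a - c *\<^sub>R (M *v a))"
    proof -
      have "M *v (M *v a) = c *\<^sub>R (M *v a) + c *\<^sub>R (M *v a) - a"
        using a(2) by (metis add_diff_cancel_right' mult_2 scaleR_add_left)
      then have "M *v (c *\<^sub>R a - M *v a) = a - c *\<^sub>R (M *v a)"
        by (simp add: matrix_vector_mult_scaleR matrix_vector_mult_diff_distrib)
      then show ?thesis
        by (simp only: b_def matrix_vector_mult_scaleR)
    qed
    \<comment> \<open>The factor sin \<theta> lets \<open>sb\<close> eliminate \<open>b\<close>; it
      is nonzero and is cancelled afterwards.\<close>
    have "sin \<theta> *\<^sub>R (M *v b) = sin \<theta> *\<^sub>R (sin \<theta> *\<^sub>R a + c *\<^sub>R b)"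
    proof -
      have s: "sin \<theta> * sin \<theta> = 1 - c * c"
        using sin_squared_eq[of \<theta>] by (simp add: power2_eq_square cos)
      have "sin \<theta> *\<^sub>R (sin \<theta> *\<^sub>R a + c *\<^sub>R b) = (sin \<theta> * sin \<theta>) *\<^sub>R a + c *\<^sub>R (sin \<theta> *\<^sub>R b)"
        by (simp add: algebra_simps)
      then show ?thesis using False unfolding sb s Mb by (simp add: algebra_simps)
    qed
    then have "M *v b = sin \<theta> *\<^sub>R a + cos \<theta> *\<^sub>R b" using False cos by simp
    moreover have "M *v a = cos \<theta> *\<^sub>R a - sin \<theta> *\<^sub>R b" by (simp add: sb cos)
    ultimately show ?thesis
      unfolding complex_eigenvalue_cis_iff using a(1) by blast
  qed
  then show "arccos c \<in> eigenangles M"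
    using le by (simp add: eigenangles_def \<theta>_def)
qed

text \<open>Finiteness makes the \<open>Min\<close> in \<open>eigengap_inverse\<close> a genuine
  minimum. It carries over from the symmetrized eigenvalues, since |\<theta>| is recovered from cos
  \<theta> by \<open>arccos\<close>.\<close>

lemma finite_abs_eigenangles:
  assumes "orthogonal_transformation ((*v) M)"
  shows "finite {\<bar>\<theta>\<bar> |\<theta>. \<theta> \<in> eigenangles M \<and> \<theta> \<noteq> 0}"
proof (rule finite_subset)
  show "{\<bar>\<theta>\<bar> |\<theta>. \<theta> \<in> eigenangles M \<and> \<theta> \<noteq> 0}
      \<subseteq> arccos ` {c. symmetrized_eigenvalue ((*v) M) c}"
  proof clarify
    fix \<theta> assume \<theta>: "\<theta> \<in> eigenangles M"
    then have "arccos (cos \<bar>\<theta>\<bar>) = \<bar>\<theta>\<bar>" by (intro arccos_cos) (auto simp: eigenangles_def)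
    then have "\<bar>\<theta>\<bar> = arccos (cos \<theta>)" by simp
    then show "\<bar>\<theta>\<bar> \<in> arccos ` {c. symmetrized_eigenvalue ((*v) M) c}"
      using eigenangle_imp_symmetrized_eigenvalue[OF \<theta>] by blast
  qed
  show "finite (arccos ` {c. symmetrized_eigenvalue ((*v) M) c})"
    using finite_symmetrized_eigenvalues[OF assms] by simp
qed

section \<open>The mean of the iterates\<close>

text \<open>The angle of the maximal symmetrized eigenvalue is a positive eigenangle. It therefore
  shows that the set under \<open>Min\<close> is nonempty and bounds the minimum from above, so pi /
  \<theta> is at most pi times the eigengap inverse.\<close>

lemma norm_sum_reflection_product_le:
  assumes "invertible A"
  shows "0 < eigengap_inverse A"
    and "norm (\<Sum>k<n. matrix_power (reflection_product A) k *v w) \<le> pi * eigengap_inverse A * norm w"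
proof -
  let ?f = "(*v) (reflection_product A)"
  let ?S = "{\<bar>\<theta>\<bar> |\<theta>. \<theta> \<in> eigenangles (reflection_product A) \<and> \<theta> \<noteq> 0}"
  note f = orthogonal_transformation_reflection_product[of A]
  note fixed = reflection_product_fixed_imp_zero[OF assms]
  obtain c where c: "symmetrized_eigenvalue ?f c" and max: "\<And>x. x \<bullet> ?f x \<le> c * (norm x)\<^sup>2"
    using exists_max_symmetrized_eigenvalue[OF f] by blast
  define \<theta> where "\<theta> = arccos c"
  note bounds = symmetrized_eigenvalue_bounds[OF f c]
  have \<theta>: "\<theta> \<in> eigenangles (reflection_product A)" "0 < \<theta>"
    unfolding \<theta>_def by (rule symmetrized_eigenvalue_imp_eigenangle[OF f fixed c]; assumption)+
  have cos: "cos \<theta> = c" "\<theta> \<le> pi" using bounds by (auto simp: \<theta>_def arccos_ubound)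
  have fin: "finite ?S" by (rule finite_abs_eigenangles[OF f])
  have mem: "\<theta> \<in> ?S" using \<theta> by force
  have Min_le: "Min ?S \<le> \<theta>" using fin mem by (rule Min_le)
  have "Min ?S \<in> ?S" using fin mem by (intro Min_in) auto
  then have Min_pos: "0 < Min ?S" by auto
  then show "0 < eigengap_inverse A" by (simp add: eigengap_inverse_def)
  have "norm (\<Sum>k<n. (?f ^^ k) w) \<le> pi / \<theta> * norm w"
    by (rule norm_sum_funpow_le[OF f fixed]) (use max cos \<theta> in auto)
  also have "\<dots> \<le> pi * eigengap_inverse A * norm w"
    using Min_le Min_pos unfolding eigengap_inverse_def
    by (intro mult_right_mono) (auto simp: frac_le)
  finally show "norm (\<Sum>k<n. matrix_power (reflection_product A) k *v w)
      \<le> pi * eigengap_inverse A * norm w"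
    by (simp add: matrix_power_mult_vec)
qed

lemma sum_even_odd: "(\<Sum>j = 0..<N. g (2 * j) + g (2 * j + 1)) = (\<Sum>k<2 * N. g k)"
  for g :: "nat \<Rightarrow> 'a::comm_monoid_add"
  by (induction N) (simp_all add: add_ac)

theorem theorem9:
  fixes A :: "real ^ 'n::{finite,linorder} ^ 'n::{finite,linorder}"
    and x0 b xs :: "real ^ 'n::{finite,linorder}"
    and y z :: "nat \<Rightarrow> real ^ 'n::{finite,linorder}"
    and \<epsilon> :: real and N :: nat
  assumes "invertible A"
    and "xs = matrix_inv A *v b"
    and "\<And>j. y j = xs + matrix_power (reflection_product A) (2 * j) *v (x0 - xs)"
    and "\<And>j. z j = xs + matrix_power (reflection_product A) (2 * j + 1) *v (x0 - xs)"
    and "\<epsilon> > 0"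
    and "N = nat \<lceil>pi * eigengap_inverse A / (2 * \<epsilon>)\<rceil>"
  shows "norm ((1 / (2 * real N)) *\<^sub>R (\<Sum>j = 0..<N. y j + z j) - xs) \<le> \<epsilon> * norm (x0 - xs)"
proof -
  define w where "w = x0 - xs"
  define g where "g k = matrix_power (reflection_product A) k *v w" for k
  \<comment> \<open>Positivity forces N to be at least 1, so the mean does not divide by
    zero.\<close>
  have "0 < pi * eigengap_inverse A / (2 * \<epsilon>)"
    using norm_sum_reflection_product_le(1)[OF assms(1)] assms(5) by simp
  moreover have N: "pi * eigengap_inverse A / (2 * \<epsilon>) \<le> real N"
    unfolding assms(6) by (rule of_nat_ceiling)
  ultimately have N_pos: "0 < real N" by linarith
  \<comment> \<open>The pairs of exponents 2 j and 2 j + 1 exhaust all exponents below 2 N, leaving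
    a single orbit sum of \<open>w\<close>.\<close>
  have "(\<Sum>j = 0..<N. y j + z j) = (\<Sum>j = 0..<N. 2 *\<^sub>R xs + (g (2 * j) + g (2 * j + 1)))"
    by (rule sum.cong) (simp_all add: assms(3,4) g_def w_def scaleR_2)
  also have "\<dots> = (2 * real N) *\<^sub>R xs + (\<Sum>k<2 * N. g k)"
    by (subst sum.distrib, subst sum_even_odd, subst sum_constant_scaleR) (simp add: mult.commute)
  finally have "(1 / (2 * real N)) *\<^sub>R (\<Sum>j = 0..<N. y j + z j) - xs
      = (1 / (2 * real N)) *\<^sub>R (\<Sum>k<2 * N. g k)"
    using N_pos by (simp add: scaleR_add_right)
  also have "norm \<dots> \<le> 1 / (2 * real N) * (pi * eigengap_inverse A * norm w)"
    using norm_sum_reflection_product_le(2)[OF assms(1), where n = "2 * N" and w = w] N_pos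
    by (simp add: g_def divide_right_mono)
  also have "\<dots> = pi * eigengap_inverse A / (2 * real N) * norm w" by simp
  also have "\<dots> \<le> \<epsilon> * norm w"
    using N N_pos assms(5) by (intro mult_right_mono) (auto simp: field_simps)
  finally show ?thesis by (simp add: w_def)
qed

end
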